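(* Let $\mathbf{X}_\tau=(X_{\tau,1},\ldots,X_{\tau,k})'$, $\tau=0,\ldots,T$, be a sequence of independently distributed random return vectors of $k$ risky assets, let $r_{f,\tau}$ be the return of the riskless asset, and let $E(\mathbf{X}_\tau)=\boldsymbol{\mu}_\tau$ and $\mathrm{Var}(\mathbf{X}_\tau)=\boldsymbol{\Sigma}_\tau$, where $\boldsymbol{\Sigma}_\tau$ is positive definite. Then for all $t=1,\ldots,T$ the (multi-period) tangency portfolio weights for period $T-t$ are given by $$\mathbf{w}^*_{TP,T-t}=\frac{\breve{\mathbf{A}}^{-1}_{T-t+1}\breve{\boldsymbol{\mu}}_{T-t+1}}{\mathbf{1}'\breve{\mathbf{A}}^{-1}_{T-t+1}\breve{\boldsymbol{\mu}}_{T-t+1}}=\frac{\boldsymbol{\Sigma}^{-1}_{T-t+1}\breve{\boldsymbol{\mu}}_{T-t+1}}{\mathbf{1}'\boldsymbol{\Sigma}^{-1}_{T-t+1}\breve{\boldsymbol{\mu}}_{T-t+1}}.$$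
   Context: $\mathbf{1}$ is the $k$-vector of ones and $'$ denotes transpose. The riskless returns $r_{f,t}$ are deterministic, $R_{f,t}=1+r_{f,t}\neq0$, $\breve{\mathbf{X}}_t=\mathbf{X}_t-r_{f,t}\mathbf{1}$, $\breve{\boldsymbol{\mu}}_t=\boldsymbol{\mu}_t-r_{f,t}\mathbf{1}$. The matrices $\breve{\mathbf{A}}_i$ and vectors $\breve{\boldsymbol{\mu}}^*_i$ are defined by backward recursion: $\breve{\mathbf{A}}_T=\boldsymbol{\Sigma}_T+\breve{\boldsymbol{\mu}}_T\breve{\boldsymbol{\mu}}_T'$, $\breve{\boldsymbol{\mu}}^*_T=\breve{\boldsymbol{\mu}}_T$, and for $i=T-1,\ldots,1$, $\breve{\mathbf{A}}_i=E[(1-\tilde{s}_{i+1})\breve{\mathbf{X}}_i\breve{\mathbf{X}}_i'\mid\mathcal{F}_{i-1}]$, $\breve{\boldsymbol{\mu}}^*_i=E[(1-\tilde{s}_{i+1})\breve{\mathbf{X}}_i\mid\mathcal{F}_{i-1}]$, where $\tilde{s}_i=\breve{\boldsymbol{\mu}}_i^{*\prime}\breve{\mathbf{A}}_i^{-1}\breve{\boldsymbol{\mu}}_i^*$. Here $\mathcal{F}_{i}$ is the information available at time $i$, and independence means that $\mathbf{X}_i$ is independent of $\mathcal{F}_{i-1}$ (so conditional and unconditional moments of $\mathbf{X}_i$ coincide). Tangency portfolio: consider the problem of maximizing $E[U(W_T)\mid\mathcal{F}_0]$, $U(W)=W-\frac{\alpha}{2}W^2$, $\alpha>0$, over risky-asset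 weights $\mathbf{w}_0,\ldots,\mathbf{w}_{T-1}\in\mathbb{R}^k$ ($\mathbf{w}_s$ depending only on $\mathcal{F}_s$) with wealth $W_t=W_{t-1}(R_{f,t}+\mathbf{w}_{t-1}'\breve{\mathbf{X}}_t)$. For independent returns the optimal weights for period $T-t$ have the form $\alpha_{T-t+1}^{-1}\boldsymbol{\Sigma}_{T-t+1}^{-1}\breve{\boldsymbol{\mu}}_{T-t+1}$ with a scalar $\alpha_{T-t+1}^{-1}$. The tangency portfolio for period $T-t$ is the vector of this form whose scalar is determined by the requirement that the whole wealth is invested into the risky assets, i.e. $\mathbf{w}_{T-t}'\mathbf{1}=1$. It is understood that $\mathbf{1}'\boldsymbol{\Sigma}^{-1}_{T-t+1}\breve{\boldsymbol{\mu}}_{T-t+1}\neq0$. *)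

theory Defs
  imports "HOL-Probability.Probability"
begin

definition pos_definite :: "real^'k^'k \<Rightarrow> bool" where
  "pos_definite S \<longleftrightarrow> transpose S = S \<and> (\<forall>x. x \<noteq> 0 \<longrightarrow> x \<bullet> (S *v x) > 0)"

definition outer :: "real^'k \<Rightarrow> real^'k \<Rightarrow> real^'k^'k" where
  "outer u v = (\<chi> a b. u $ a * v $ b)"

definition mean_vector :: "'a measure \<Rightarrow> ('a \<Rightarrow> real^'k) \<Rightarrow> real^'k" where
  "mean_vector M Y = (\<chi> a. \<integral>\<omega>. Y \<omega> $ a \<partial>M)"

definition covariance_matrix :: "'a measure \<Rightarrow> ('a \<Rightarrow> real^'k) \<Rightarrow> real^'k^'k" where
  "covariance_matrix M Y =
     (\<chi> a b. \<integral>\<omega>. (Y \<omega> $ a - mean_vector M Y $ a) * (Y \<omega> $ b - mean_vector M Y $ b) \<partial>M)"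

(* The numeral 1 at type real^'k is the all-ones vector (one_vec_def). *)
definition excess_return ::
    "(nat \<Rightarrow> real) \<Rightarrow> (nat \<Rightarrow> 'a \<Rightarrow> real^'k) \<Rightarrow> nat \<Rightarrow> 'a \<Rightarrow> real^'k" where
  "excess_return rf X i \<omega> = X i \<omega> - rf i *\<^sub>R 1"

definition excess_mean :: "(nat \<Rightarrow> real) \<Rightarrow> (nat \<Rightarrow> real^'k) \<Rightarrow> nat \<Rightarrow> real^'k" where
  "excess_mean rf \<mu> i = \<mu> i - rf i *\<^sub>R 1"

(* Arguments: returns Xb in excess of the riskless rate, their means mb, covariances S, horizon T.
   The conditional expectations are random and are the particular versions chosen by
   real_cond_exp, so identities about them are to be read almost surely.
   The index range of interest is 1 \<le> i \<le> T; for i > T the terminal values are repeated. *)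
function A_breve :: "'a measure \<Rightarrow> (nat \<Rightarrow> 'a measure) \<Rightarrow> (nat \<Rightarrow> 'a \<Rightarrow> real^'k) \<Rightarrow>
      (nat \<Rightarrow> real^'k) \<Rightarrow> (nat \<Rightarrow> real^'k^'k) \<Rightarrow> nat \<Rightarrow> nat \<Rightarrow> 'a \<Rightarrow> real^'k^'k"
  and mu_star :: "'a measure \<Rightarrow> (nat \<Rightarrow> 'a measure) \<Rightarrow> (nat \<Rightarrow> 'a \<Rightarrow> real^'k) \<Rightarrow>
      (nat \<Rightarrow> real^'k) \<Rightarrow> (nat \<Rightarrow> real^'k^'k) \<Rightarrow> nat \<Rightarrow> nat \<Rightarrow> 'a \<Rightarrow> real^'k"
  and s_tilde :: "'a measure \<Rightarrow> (nat \<Rightarrow> 'a measure) \<Rightarrow> (nat \<Rightarrow> 'a \<Rightarrow> real^'k) \<Rightarrow>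
      (nat \<Rightarrow> real^'k) \<Rightarrow> (nat \<Rightarrow> real^'k^'k) \<Rightarrow> nat \<Rightarrow> nat \<Rightarrow> 'a \<Rightarrow> real"
where
  "A_breve M F Xb mb S T i \<omega> =
     (if T \<le> i then S T + outer (mb T) (mb T)
      else (\<chi> a b. real_cond_exp M (F (i - 1))
              (\<lambda>\<omega>'. (1 - s_tilde M F Xb mb S T (i + 1) \<omega>') * outer (Xb i \<omega>') (Xb i \<omega>') $ a $ b) \<omega>))"
| "mu_star M F Xb mb S T i \<omega> =
     (if T \<le> i then mb T
      else (\<chi> a. real_cond_exp M (F (i - 1))
              (\<lambda>\<omega>'. (1 - s_tilde M F Xb mb S T (i + 1) \<omega>') * Xb i \<omega>' $ a) \<omega>))"
| "s_tilde M F Xb mb S T i \<omega> =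
     mu_star M F Xb mb S T i \<omega> \<bullet>
       (matrix_inv (A_breve M F Xb mb S T i \<omega>) *v mu_star M F Xb mb S T i \<omega>)"
  by pat_completeness auto
termination
  by (relation "Wellfounded.measure (\<lambda>p. case p of
        Inl (M, F, Xb, mb, S, T, i, \<omega>) \<Rightarrow> 2 * (T - i)
      | Inr (Inl (M, F, Xb, mb, S, T, i, \<omega>)) \<Rightarrow> 2 * (T - i)
      | Inr (Inr (M, F, Xb, mb, S, T, i, \<omega>)) \<Rightarrow> 2 * (T - i) + 1)") auto

(* The unconditional equations would make the simplifier unfold the recursion indefinitely. *)
declare A_breve.simps [simp del] mu_star.simps [simp del] s_tilde.simps [simp del]

(* The optimal weights of the quadratic-utility investor under independence are a scalar multiple
   of inverse(S) m, with S and m the covariance matrix and mean excess return of the period; the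
   tangency portfolio is the vector of that form that puts the whole wealth into the risky
   assets. *)
definition is_tangency_portfolio :: "real^'k^'k \<Rightarrow> real^'k \<Rightarrow> real^'k \<Rightarrow> bool" where
  "is_tangency_portfolio S m w \<longleftrightarrow> (\<exists>c. w = c *\<^sub>R (matrix_inv S *v m)) \<and> w \<bullet> 1 = 1"

end

theory Submission
  imports Defs
begin

text \<open>By independence, $\breve A_i$ and $\breve\mu^*_i$ are almost surely the same deterministic
  multiple $c_i$ of $\Sigma_i + \breve\mu_i\breve\mu_i'$ and $\breve\mu_i$.  With
  $q_i = \breve\mu_i'\Sigma_i^{-1}\breve\mu_i \ge 0$, the Sherman--Morrison formula turns this into
  $\tilde s_i = c_i q_i/(1+q_i)$, so that $c_T = 1$ and $c_{i-1} = 1 - \tilde s_i$ keep every $c_i$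
  in $(0,1]$.  The same formula shows that $\breve A_i^{-1}\breve\mu_i$ is a positive multiple of
  $\Sigma_i^{-1}\breve\mu_i$, and the multiple cancels in the normalisation.\<close>

section \<open>Linear algebra: positive definite matrices and their rank-one updates\<close>

lemma outer_mult_vector: "outer u v *v x = (v \<bullet> x) *\<^sub>R u"
  by (simp add: vec_eq_iff outer_def matrix_vector_mult_def inner_vec_def sum_distrib_left
      algebra_simps)

text \<open>A kernel vector makes the form vanish, so the kernel is trivial. This serves both
  \<open>pos_definite\<close> matrices and their scaled rank-one updates.\<close>

lemma invertible_if_quadratic_form_pos:
  fixes S :: "real^'k^'k"
  assumes "\<And>x. x \<noteq> 0 \<Longrightarrow> x \<bullet> (S *v x) > 0"
  shows "invertible S"
proof -
  have "\<forall>x. S *v x = 0 \<longrightarrow> x = 0"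
    using assms by (metis inner_zero_right less_irrefl)
  then show ?thesis
    by (simp add: invertible_left_inverse matrix_left_invertible_ker)
qed

lemma matrix_inv_inverse:
  fixes S :: "real^'k^'k"
  assumes "invertible S"
  shows matrix_inv_right: "S ** matrix_inv S = mat 1"
    and matrix_inv_left: "matrix_inv S ** S = mat 1"
  using someI_ex[OF assms[unfolded invertible_def]] by (simp_all add: matrix_inv_def)

lemma matrix_inv_mult_vector_eqI:
  fixes S :: "real^'k^'k"
  assumes "invertible S" "S *v x = b"
  shows "matrix_inv S *v b = x"
  by (simp add: assms(1) assms(2)[symmetric] matrix_vector_mul_assoc matrix_inv_left)

lemma pos_definite_invertible: "pos_definite S \<Longrightarrow> invertible S"
  unfolding pos_definite_def by (blast intro: invertible_if_quadratic_form_pos)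

text \<open>Writing \<open>m = S *v u\<close> turns the form of the inverse at \<open>m\<close> into
  the form of \<open>S\<close> at \<open>u\<close>.\<close>

lemma pos_definite_inv_form_nonneg:
  fixes S :: "real^'k^'k"
  assumes "pos_definite S"
  shows "m \<bullet> (matrix_inv S *v m) \<ge> 0"
proof -
  define u where "u = matrix_inv S *v m"
  have m: "S *v u = m"
    using pos_definite_invertible[OF assms]
    by (simp add: u_def matrix_vector_mul_assoc matrix_inv_right)
  have "u \<bullet> (S *v u) \<ge> 0"
    using assms by (cases "u = 0") (auto simp: pos_definite_def intro: less_imp_le)
  then show ?thesis
    unfolding m by (simp add: u_def inner_commute)
qed

text \<open>Only the action of the inverse on \<open>m\<close> itself is required, so the full
  Sherman-Morrison matrix identity can be bypassed. If \<open>S *v u = m\<close>, then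
  \<open>S + outer m m\<close> sends \<open>u\<close> to \<open>(1 + m \<bullet> u)\<close> times
  \<open>m\<close>, and rescaling \<open>u\<close> solves the linear system.\<close>

lemma scaled_rank_one_update:
  fixes S :: "real^'k^'k"
  assumes S: "pos_definite S" and c: "c > 0"
  shows invertible_scaled_rank_one_update: "invertible (c *\<^sub>R (S + outer m m))"
    and matrix_inv_scaled_rank_one_update: "matrix_inv (c *\<^sub>R (S + outer m m)) *v m
      = (1 / (c * (1 + m \<bullet> (matrix_inv S *v m)))) *\<^sub>R (matrix_inv S *v m)"
proof -
  have app: "(c *\<^sub>R (S + outer m m)) *v x = c *\<^sub>R (S *v x + (m \<bullet> x) *\<^sub>R m)" for x
    by (simp add: scaleR_matrix_vector_assoc[symmetric] matrix_vector_mult_add_rdistrib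
        outer_mult_vector)
  show inv: "invertible (c *\<^sub>R (S + outer m m))"
  proof (rule invertible_if_quadratic_form_pos)
    fix x :: "real^'k" assume "x \<noteq> 0"
    then have "x \<bullet> (S *v x) > 0"
      using S by (simp add: pos_definite_def)
    \<comment> \<open>The rank-one term contributes a square to the quadratic form.\<close>
    moreover have "(m \<bullet> x) * (x \<bullet> m) \<ge> 0"
      by (simp add: inner_commute)
    ultimately show "x \<bullet> ((c *\<^sub>R (S + outer m m)) *v x) > 0"
      unfolding app using c by (simp add: inner_add_right)
  qed
  define u where "u = matrix_inv S *v m"
  have m: "S *v u = m"
    using pos_definite_invertible[OF S]
    by (simp add: u_def matrix_vector_mul_assoc matrix_inv_right)
  define d where "d = 1 / (c * (1 + m \<bullet> u))"
  have "1 + m \<bullet> u > 0"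
    using pos_definite_inv_form_nonneg[OF S, of m] by (simp add: u_def)
  then have d: "c * (d * (1 + m \<bullet> u)) = 1"
    using c by (simp add: d_def)
  have "(c *\<^sub>R (S + outer m m)) *v (d *\<^sub>R u) = (c * (d * (1 + m \<bullet> u))) *\<^sub>R m"
    unfolding app by (simp add: matrix_vector_mult_scaleR m algebra_simps)
  with matrix_inv_mult_vector_eqI[OF inv, of "d *\<^sub>R u" m] d
  show "matrix_inv (c *\<^sub>R (S + outer m m)) *v m
      = (1 / (c * (1 + m \<bullet> (matrix_inv S *v m)))) *\<^sub>R (matrix_inv S *v m)"
    by (simp add: d_def u_def)
qed

section \<open>Measurability of the matrix inverse and of the backward recursion\<close>

lemma borel_measurable_vec_nth [measurable]:
  fixes f :: "'a \<Rightarrow> 'b::second_countable_topology^'k"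
  assumes "f \<in> borel_measurable M"
  shows "(\<lambda>x. f x $ i) \<in> borel_measurable M"
  by (rule borel_measurable_continuous_on[OF _ assms]) (intro continuous_intros)

lemma borel_measurable_det:
  fixes f :: "'a \<Rightarrow> real^'k^'k"
  assumes [measurable]: "\<And>i j. (\<lambda>x. f x $ i $ j) \<in> borel_measurable M"
  shows "(\<lambda>x. det (f x)) \<in> borel_measurable M"
  unfolding det_def by measurable

text \<open>On singular matrices the choice operator in the definition of matrix_inv has an unsatisfiable
  argument that no longer depends on the matrix, so the value is a constant there.\<close>

lemma matrix_inv_singular:
  fixes B :: "real^'k^'k"
  assumes "\<not> invertible B"
  shows "matrix_inv B = (SOME C. False)"
proof -
  have "(\<lambda>C. B ** C = mat 1 \<and> C ** B = mat 1) = (\<lambda>C. False)"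
    using assms by (auto simp: invertible_def)
  then show ?thesis
    unfolding matrix_inv_def by simp
qed

text \<open>Cramer's rule gives a quotient of determinants where \<open>f x\<close> is invertible;
  elsewhere the inverse is one fixed matrix. The singular set is included because measurability
  concerns every point, whereas the recursion is controlled only almost everywhere.\<close>

lemma borel_measurable_matrix_inv_mult:
  fixes f :: "'a \<Rightarrow> real^'k^'k" and g :: "'a \<Rightarrow> real^'k"
  assumes f [measurable]: "\<And>i j. (\<lambda>x. f x $ i $ j) \<in> borel_measurable M"
    and g [measurable]: "\<And>i. (\<lambda>x. g x $ i) \<in> borel_measurable M"
  shows "(\<lambda>x. (matrix_inv (f x) *v g x) $ k) \<in> borel_measurable M"
proof -
  define K :: "real^'k^'k" where "K = (SOME C. False)"
  \<comment> \<open>The numerator matrix of Cramer's rule: column \<open>k\<close> of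
    \<open>f x\<close> is replaced by \<open>g x\<close>.\<close>
  define h where "h x = (\<chi> i j. if j = k then g x $ i else f x $ i $ j)" for x
  have eq: "(matrix_inv (f x) *v g x) $ k =
      (if det (f x) \<noteq> 0 then det (h x) / det (f x) else (\<Sum>j\<in>UNIV. K $ k $ j * g x $ j))" for x
  proof (cases "det (f x) = 0")
    case True
    then have "\<not> invertible (f x)"
      by (simp add: invertible_det_nz)
    then show ?thesis
      using True by (simp add: matrix_inv_singular K_def matrix_vector_mult_def)
  next
    case False
    then have "f x *v (matrix_inv (f x) *v g x) = g x"
      by (simp add: invertible_det_nz[symmetric] matrix_vector_mul_assoc matrix_inv_right)
    then have "matrix_inv (f x) *v g x
        = (\<chi> k. det (\<chi> i j. if j = k then g x $ i else f x $ i $ j) / det (f x))"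
      using cramer[OF False] by blast
    then have "(matrix_inv (f x) *v g x) $ k
        = (\<chi> k. det (\<chi> i j. if j = k then g x $ i else f x $ i $ j) / det (f x)) $ k"
      by (rule arg_cong)
    with False show ?thesis
      by (simp add: h_def)
  qed
  have h: "(\<lambda>x. h x $ i $ j) \<in> borel_measurable M" for i j
    by (cases "j = k") (simp_all add: h_def)
  note [measurable] = borel_measurable_det[OF f] borel_measurable_det[OF h]
  show ?thesis
    unfolding eq by measurable
qed

text \<open>No induction along the recursion is involved: each entry is either constant or a
  \<open>real_cond_exp\<close>, which is measurable whatever its integrand.\<close>

lemma borel_measurable_A_breve:
  "(\<lambda>\<omega>. A_breve M F Xb mb S T i \<omega> $ a $ b) \<in> borel_measurable M"
  by (cases "T \<le> i") (simp_all add: A_breve.simps borel_measurable_cond_exp2)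

lemma borel_measurable_mu_star:
  "(\<lambda>\<omega>. mu_star M F Xb mb S T i \<omega> $ a) \<in> borel_measurable M"
  by (cases "T \<le> i") (simp_all add: mu_star.simps borel_measurable_cond_exp2)

text \<open>This allows \<open>1 - s_tilde\<close> to be replaced by an almost surely equal constant
  inside a conditional expectation.\<close>

lemma borel_measurable_s_tilde [measurable]:
  "s_tilde M F Xb mb S T i \<in> borel_measurable M"
proof -
  note [measurable] = borel_measurable_mu_star
    borel_measurable_matrix_inv_mult[OF borel_measurable_A_breve borel_measurable_mu_star]
  show ?thesis
    unfolding s_tilde.simps[abs_def] inner_vec_def inner_real_def by measurable
qed

section \<open>Conditional expectations under independence, moments, and the backward
  induction\<close>

context prob_space
begin

text \<open>The constant has the defining property of the conditional expectation: for
  \<open>A\<close> in \<open>G\<close>, the indicator of \<open>A\<close> is independent of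
  \<open>g (Y \<omega>)\<close>, so the integral over \<open>A\<close> factorises.\<close>

lemma real_cond_exp_indep:
  fixes Y :: "'a \<Rightarrow> 'b::{second_countable_topology, topological_space}" and g :: "'b \<Rightarrow> real"
  assumes sub: "subalgebra M G"
    and Y [measurable]: "Y \<in> borel_measurable M"
    and indep: "indep_set (sets G) (sets (vimage_algebra (space M) Y borel))"
    and g [measurable]: "g \<in> borel_measurable borel"
    and int: "integrable M (\<lambda>\<omega>. g (Y \<omega>))"
  shows "AE \<omega> in M. real_cond_exp M G (\<lambda>\<omega>. g (Y \<omega>)) \<omega> = expectation (\<lambda>\<omega>. g (Y \<omega>))"
proof -
  interpret finite_measure_subalgebra M G
    by unfold_locales (rule sub)
  show ?thesis
  proof (rule real_cond_exp_charact)
    fix A assume A: "A \<in> sets G"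
    then have AM [measurable]: "A \<in> sets M"
      using sub by (auto simp: subalgebra_def)
    define I :: "'a \<Rightarrow> real" where "I = indicator A"
    have I [measurable]: "I \<in> borel_measurable G"
      unfolding I_def using A by simp
    have IM [measurable]: "I \<in> borel_measurable M"
      unfolding I_def by simp
    have IG: "I -` B \<inter> space M \<in> sets G" if "B \<in> sets borel" for B
      using measurable_sets[OF I that] sub by (simp add: subalgebra_def)
    have Yg: "(\<lambda>\<omega>. g (Y \<omega>)) -` B \<inter> space M \<in> sets (vimage_algebra (space M) Y borel)"
      if "B \<in> sets borel" for B
    proof -
      have "(\<lambda>\<omega>. g (Y \<omega>)) -` B \<inter> space M = Y -` (g -` B) \<inter> space M"
        by auto
      moreover have "g -` B \<in> sets borel"
        using measurable_sets[OF g that] by simp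
      ultimately show ?thesis
        by (auto intro: in_vimage_algebra)
    qed
    have "indep_var borel I borel (\<lambda>\<omega>. g (Y \<omega>))"
      unfolding indep_var_eq
    proof (intro conjI)
      \<comment> \<open>The sigma-algebras generated by \<open>I\<close> and by \<open>g\<close>
        after \<open>Y\<close> lie inside \<open>G\<close> and inside the one generated by
        \<open>Y\<close>, and independence passes to smaller families.\<close>
      have "sigma_sets (space M) {I -` B \<inter> space M | B. B \<in> sets borel} \<subseteq> sets G"
        using sets.sigma_sets_subset[of "{I -` B \<inter> space M | B. B \<in> sets borel}" G] IG sub
        by (auto simp: subalgebra_def)
      moreover have "sigma_sets (space M) {(\<lambda>\<omega>. g (Y \<omega>)) -` B \<inter> space M | B. B \<in> sets borel}
          \<subseteq> sets (vimage_algebra (space M) Y borel)"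
        using sets.sigma_sets_subset[of "{(\<lambda>\<omega>. g (Y \<omega>)) -` B \<inter> space M | B. B \<in> sets borel}"
            "vimage_algebra (space M) Y borel"] Yg
        by auto
      ultimately show "indep_set
          (sigma_sets (space M) {I -` B \<inter> space M | B. B \<in> sets borel})
          (sigma_sets (space M) {(\<lambda>\<omega>. g (Y \<omega>)) -` B \<inter> space M | B. B \<in> sets borel})"
        using indep unfolding indep_set_def
        by (elim indep_sets_mono_sets) (auto split: bool.split)
    qed measurable
    then have "expectation (\<lambda>\<omega>. I \<omega> * g (Y \<omega>)) = expectation I * expectation (\<lambda>\<omega>. g (Y \<omega>))"
      by (rule indep_var_lebesgue_integral)
         (use int in \<open>auto simp: I_def integrable_indicator_iff less_top[symmetric]\<close>)
    then show "(\<integral>\<omega>\<in>A. g (Y \<omega>) \<partial>M) = (\<integral>\<omega>\<in>A. expectation (\<lambda>\<omega>. g (Y \<omega>)) \<partial>M)"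
      by (simp add: set_lebesgue_integral_def I_def)
  qed (use int in auto)
qed

text \<open>Conditional expectation sees its integrand only up to null sets, so \<open>z\<close>
  becomes \<open>c\<close> first, and independence is applied to \<open>c * g y\<close>
  afterwards.\<close>

lemma real_cond_exp_indep_AE_const_mult:
  fixes Y :: "'a \<Rightarrow> 'b::{second_countable_topology, topological_space}" and g :: "'b \<Rightarrow> real"
  assumes sub: "subalgebra M G"
    and Y [measurable]: "Y \<in> borel_measurable M"
    and indep: "indep_set (sets G) (sets (vimage_algebra (space M) Y borel))"
    and g [measurable]: "g \<in> borel_measurable borel"
    and int: "integrable M (\<lambda>\<omega>. g (Y \<omega>))"
    and z [measurable]: "z \<in> borel_measurable M"
    and zc: "AE \<omega> in M. z \<omega> = c"
  shows "AE \<omega> in M.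
    real_cond_exp M G (\<lambda>\<omega>. z \<omega> * g (Y \<omega>)) \<omega> = c * expectation (\<lambda>\<omega>. g (Y \<omega>))"
proof -
  interpret finite_measure_subalgebra M G
    by unfold_locales (rule sub)
  have "AE \<omega> in M. real_cond_exp M G (\<lambda>\<omega>. z \<omega> * g (Y \<omega>)) \<omega>
      = real_cond_exp M G (\<lambda>\<omega>. c * g (Y \<omega>)) \<omega>"
    by (rule real_cond_exp_cong) (use zc in auto)
  moreover have "AE \<omega> in M. real_cond_exp M G (\<lambda>\<omega>. c * g (Y \<omega>)) \<omega>
      = expectation (\<lambda>\<omega>. c * g (Y \<omega>))"
    by (rule real_cond_exp_indep[OF sub Y indep, of "\<lambda>y. c * g y"]) (use int in auto)
  ultimately show ?thesis
    by eventually_elim simp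
qed

text \<open>Products of coordinates are dominated by the squared norm; first moments follow because
  the measure is finite.\<close>

lemma integrable_vec_nth_if_square_integrable:
  fixes Y :: "'a \<Rightarrow> real^'k"
  assumes [measurable]: "Y \<in> borel_measurable M" and int: "integrable M (\<lambda>\<omega>. (norm (Y \<omega>))\<^sup>2)"
  shows "integrable M (\<lambda>\<omega>. Y \<omega> $ a)" and "integrable M (\<lambda>\<omega>. Y \<omega> $ a * Y \<omega> $ b)"
proof -
  have "\<bar>y $ a\<bar> * \<bar>y $ b\<bar> \<le> (norm y)\<^sup>2" for y :: "real^'k" and a b
    by (simp add: power2_eq_square mult_mono component_le_norm_cart)
  then have bound: "norm (y $ a * y $ b) \<le> norm ((norm y)\<^sup>2)" for y :: "real^'k" and a b
    by (simp only: real_norm_def abs_mult abs_power2)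
  have prod: "integrable M (\<lambda>\<omega>. Y \<omega> $ a * Y \<omega> $ b)" for a b
  proof (rule Bochner_Integration.integrable_bound[OF int])
    show "(\<lambda>\<omega>. Y \<omega> $ a * Y \<omega> $ b) \<in> borel_measurable M"
      by measurable
  qed (rule AE_I2, rule bound)
  then show "integrable M (\<lambda>\<omega>. Y \<omega> $ a * Y \<omega> $ b)" .
  have "integrable M (\<lambda>\<omega>. (Y \<omega> $ a)\<^sup>2)"
    unfolding power2_eq_square by (rule prod)
  then show "integrable M (\<lambda>\<omega>. Y \<omega> $ a)"
    by (rule square_integrable_imp_integrable[rotated]) measurable
qed

lemma expectation_excess_return:
  fixes X :: "nat \<Rightarrow> 'a \<Rightarrow> real^'k"
  assumes Y: "X i \<in> borel_measurable M" "integrable M (\<lambda>\<omega>. (norm (X i \<omega>))\<^sup>2)"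
    and mean: "mean_vector M (X i) = \<mu> i"
  shows "expectation (\<lambda>\<omega>. excess_return rf X i \<omega> $ a) = excess_mean rf \<mu> i $ a"
    and "expectation (\<lambda>\<omega>. outer (excess_return rf X i \<omega>) (excess_return rf X i \<omega>) $ a $ b)
      = (covariance_matrix M (X i) + outer (excess_mean rf \<mu> i) (excess_mean rf \<mu> i)) $ a $ b"
proof -
  note int = integrable_vec_nth_if_square_integrable[OF Y]
  have m: "expectation (\<lambda>\<omega>. X i \<omega> $ j) = \<mu> i $ j" for j
    by (simp add: mean[symmetric] mean_vector_def)
  show "expectation (\<lambda>\<omega>. excess_return rf X i \<omega> $ a) = excess_mean rf \<mu> i $ a"
    by (simp add: excess_return_def excess_mean_def int m prob_space)
  \<comment> \<open>Arbitrary centres \<open>p\<close> and \<open>q\<close> let one expansion serve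
    twice: centred at the means it gives the covariance, centred at \<open>rf i\<close> the second
    moments of the excess returns.\<close>
  have prod: "expectation (\<lambda>\<omega>. (X i \<omega> $ a - p) * (X i \<omega> $ b - q)) =
      expectation (\<lambda>\<omega>. X i \<omega> $ a * X i \<omega> $ b) - q * \<mu> i $ a - p * \<mu> i $ b + p * q" for p q
  proof -
    have "(\<lambda>\<omega>. (X i \<omega> $ a - p) * (X i \<omega> $ b - q)) =
        (\<lambda>\<omega>. X i \<omega> $ a * X i \<omega> $ b - q * X i \<omega> $ a - p * X i \<omega> $ b + p * q)"
      by (auto simp: algebra_simps)
    then show ?thesis
      by (simp add: int m prob_space)
  qed
  show "expectation (\<lambda>\<omega>. outer (excess_return rf X i \<omega>) (excess_return rf X i \<omega>) $ a $ b)
      = (covariance_matrix M (X i) + outer (excess_mean rf \<mu> i) (excess_mean rf \<mu> i)) $ a $ b"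
    by (simp add: outer_def excess_return_def excess_mean_def covariance_matrix_def mean prod)
       (simp add: algebra_simps)
qed

text \<open>The factor \<open>c\<close> is chosen before \<omega> and shared by both quantities, so
  \<open>s_tilde\<close> is almost surely constant and leaves the next conditional expectation. The
  bound \<open>c \<le> 1\<close> is carried along to keep the next factor positive.\<close>

lemma A_breve_mu_star_AE_proportional:
  fixes X :: "nat \<Rightarrow> 'a \<Rightarrow> real^'k"
  assumes sub: "\<And>i. subalgebra M (F i)"
    and meas: "\<And>i. i \<le> T \<Longrightarrow> X i \<in> borel_measurable M"
    and indep: "\<And>i. 1 \<le> i \<Longrightarrow> i \<le> T \<Longrightarrow>
           indep_set (sets (F (i - 1))) (sets (vimage_algebra (space M) (X i) borel))"
    and int: "\<And>i. i \<le> T \<Longrightarrow> integrable M (\<lambda>\<omega>. (norm (X i \<omega>))\<^sup>2)"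
    and mean: "\<And>i. i \<le> T \<Longrightarrow> mean_vector M (X i) = \<mu> i"
    and cov: "\<And>i. i \<le> T \<Longrightarrow> covariance_matrix M (X i) = \<Sigma> i"
    and pd: "\<And>i. i \<le> T \<Longrightarrow> pos_definite (\<Sigma> i)"
    and i: "1 \<le> i" "i \<le> T"
  shows "\<exists>c. 0 < c \<and> c \<le> 1 \<and> (AE \<omega> in M.
      A_breve M F (excess_return rf X) (excess_mean rf \<mu>) \<Sigma> T i \<omega>
        = c *\<^sub>R (\<Sigma> i + outer (excess_mean rf \<mu> i) (excess_mean rf \<mu> i)) \<and>
      mu_star M F (excess_return rf X) (excess_mean rf \<mu>) \<Sigma> T i \<omega> = c *\<^sub>R excess_mean rf \<mu> i)"
  \<comment> \<open>The induction descends from \<open>T\<close> along \<open>i \<le> T\<close>,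
    while \<open>1 \<le> i\<close> joins the claim, so that \<open>F (n - 1)\<close> is the true
    predecessor in the step.\<close>
  using i(2,1)
proof (induction rule: inc_induct)
  case base
  show ?case
    by (intro exI[of _ 1]) (simp add: A_breve.simps mu_star.simps)
next
  case (step n)
  define m where "m = excess_mean rf \<mu>"
  define Xb where "Xb = excess_return rf X"
  obtain c where c: "0 < c" "c \<le> 1"
    and AE_c: "AE \<omega> in M.
      A_breve M F Xb m \<Sigma> T (Suc n) \<omega> = c *\<^sub>R (\<Sigma> (Suc n) + outer (m (Suc n)) (m (Suc n))) \<and>
      mu_star M F Xb m \<Sigma> T (Suc n) \<omega> = c *\<^sub>R m (Suc n)"
    using step.IH unfolding m_def Xb_def by auto
  define q where "q = m (Suc n) \<bullet> (matrix_inv (\<Sigma> (Suc n)) *v m (Suc n))"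
  have pdS: "pos_definite (\<Sigma> (Suc n))"
    using pd step.hyps by simp
  have q: "q \<ge> 0"
    unfolding q_def using pdS by (rule pos_definite_inv_form_nonneg)
  \<comment> \<open>The factor at \<open>n\<close>, namely \<open>1 - s_tilde\<close> at
    \<open>n + 1\<close>; it is positive since \<open>c \<le> 1\<close> and
    \<open>q / (1 + q) < 1\<close>.\<close>
  define d where "d = 1 - c * (q / (1 + q))"
  define r where "r = q / (1 + q)"
  have r: "0 \<le> r" "r < 1"
    using q by (simp_all add: r_def field_simps)
  then have "0 \<le> c * r" "c * r \<le> r"
    using c by (simp_all add: mult_left_le_one_le)
  with r have d: "0 < d" "d \<le> 1"
    by (simp_all add: d_def r_def)
  have AE_d: "AE \<omega> in M. 1 - s_tilde M F Xb m \<Sigma> T (n + 1) \<omega> = d"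
    using AE_c
  proof eventually_elim
    case (elim \<omega>)
    \<comment> \<open>The two outer factors \<open>c\<close> come from the two occurrences of
      \<open>mu_star\<close>, the inner one from inverting \<open>A_breve\<close>; a single
      \<open>c\<close> survives.\<close>
    have "1 - s_tilde M F Xb m \<Sigma> T (n + 1) \<omega> = 1 - c * (c * (q / (c * (1 + q))))"
      by (simp add: s_tilde.simps elim matrix_vector_mult_scaleR
          matrix_inv_scaled_rank_one_update[OF pdS c(1)] q_def)
    then show ?case
      using c q by (simp add: d_def)
  qed
  have n: "n \<le> T" "\<not> T \<le> n"
    using step.hyps by auto
  have Y: "X n \<in> borel_measurable M"
    using meas n by simp
  note moments = expectation_excess_return[where X = X and \<mu> = \<mu> and i = n and rf = rf,
      OF Y int[OF n(1)] mean[OF n(1)], folded m_def Xb_def]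
  note intX = integrable_vec_nth_if_square_integrable[OF Y int[OF n(1)]]
  have intXb: "integrable M (\<lambda>\<omega>. X n \<omega> $ a - rf n)"
    "integrable M (\<lambda>\<omega>. (X n \<omega> $ a - rf n) * (X n \<omega> $ b - rf n))" for a b
    by (simp_all add: intX algebra_simps)
  \<comment> \<open>Here \<open>z\<close> is \<open>1 - s_tilde\<close> and its constant value is
    \<open>d\<close>. The function \<open>g\<close> remains free: a coordinate of the excess return
    for \<open>mu_star\<close>, a product of two coordinates for \<open>A_breve\<close>.\<close>
  note cond_exp = real_cond_exp_indep_AE_const_mult[OF sub Y indep[OF step.prems n(1)] _ _ _ AE_d]
  have mu: "AE \<omega> in M. real_cond_exp M (F (n - 1))
      (\<lambda>\<omega>'. (1 - s_tilde M F Xb m \<Sigma> T (n + 1) \<omega>') * Xb n \<omega>' $ a) \<omega> = d * m n $ a" for a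
    using cond_exp[of "\<lambda>x. x $ a - rf n"] intXb moments(1)[of a]
    by (simp add: Xb_def excess_return_def)
  have A: "AE \<omega> in M. real_cond_exp M (F (n - 1))
      (\<lambda>\<omega>'. (1 - s_tilde M F Xb m \<Sigma> T (n + 1) \<omega>') * outer (Xb n \<omega>') (Xb n \<omega>') $ a $ b) \<omega>
        = d * (\<Sigma> n + outer (m n) (m n)) $ a $ b" for a b
    using cond_exp[of "\<lambda>x. (x $ a - rf n) * (x $ b - rf n)"] intXb moments(2)[of a b] cov[OF n(1)]
    by (simp add: Xb_def excess_return_def outer_def)
  \<comment> \<open>There are only finitely many entries, so one null set serves all of them and the
    entrywise identities combine into vector and matrix identities.\<close>
  have "AE \<omega> in M. (\<forall>a. real_cond_exp M (F (n - 1))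
      (\<lambda>\<omega>'. (1 - s_tilde M F Xb m \<Sigma> T (n + 1) \<omega>') * Xb n \<omega>' $ a) \<omega> = d * m n $ a) \<and>
    (\<forall>a b. real_cond_exp M (F (n - 1))
      (\<lambda>\<omega>'. (1 - s_tilde M F Xb m \<Sigma> T (n + 1) \<omega>') * outer (Xb n \<omega>') (Xb n \<omega>') $ a $ b) \<omega>
        = d * (\<Sigma> n + outer (m n) (m n)) $ a $ b)"
    using mu A by (simp add: AE_all_countable)
  then have "AE \<omega> in M.
      A_breve M F Xb m \<Sigma> T n \<omega> = d *\<^sub>R (\<Sigma> n + outer (m n) (m n)) \<and>
      mu_star M F Xb m \<Sigma> T n \<omega> = d *\<^sub>R m n"
    by eventually_elim (use n in \<open>simp add: A_breve.simps mu_star.simps vec_eq_iff\<close>)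
  then show ?case
    using d unfolding m_def Xb_def by blast
qed

end

section \<open>The budget normalisation and the two weight formulas\<close>

lemma is_tangency_portfolio_iff:
  assumes "1 \<bullet> (matrix_inv S *v m) \<noteq> 0"
  shows "is_tangency_portfolio S m w \<longleftrightarrow>
    w = (matrix_inv S *v m) /\<^sub>R (1 \<bullet> (matrix_inv S *v m))"
proof -
  \<comment> \<open>The budget constraint is linear in the scalar: it forces the reciprocal of the
    coordinate sum, and a nonzero sum makes that choice admissible.\<close>
  have "c = inverse (1 \<bullet> u)" if "c * (u \<bullet> 1) = 1" for c and u :: "real^'k"
    using that by (simp add: inner_commute inverse_unique mult.commute)
  moreover have "inverse (1 \<bullet> u) * (u \<bullet> 1) = 1" if "1 \<bullet> u \<noteq> 0" for u :: "real^'k"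
    using that by (simp add: inner_commute)
  ultimately show ?thesis
    using assms unfolding is_tangency_portfolio_def by auto
qed

theorem theorem3:
  fixes M :: "'a measure"
    and F :: "nat \<Rightarrow> 'a measure"
    and X :: "nat \<Rightarrow> 'a \<Rightarrow> real^'k"
    and rf :: "nat \<Rightarrow> real"
    and \<mu> :: "nat \<Rightarrow> real^'k"
    and \<Sigma> :: "nat \<Rightarrow> real^'k^'k"
    and T t :: nat
  assumes "prob_space M"
    and "filtration (space M) F"
    and "\<And>i. subalgebra M (F i)"
    and "\<And>i. i \<le> T \<Longrightarrow> X i \<in> borel_measurable (F i)"
    and "prob_space.indep_vars M (\<lambda>_. borel) X {0..T}"
    and "\<And>i. 1 \<le> i \<Longrightarrow> i \<le> T \<Longrightarrow>
           prob_space.indep_set M (sets (F (i - 1))) (sets (vimage_algebra (space M) (X i) borel))"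
    and "\<And>i. i \<le> T \<Longrightarrow> integrable M (\<lambda>\<omega>. (norm (X i \<omega>))\<^sup>2)"
    and "\<And>i. i \<le> T \<Longrightarrow> mean_vector M (X i) = \<mu> i"
    and "\<And>i. i \<le> T \<Longrightarrow> covariance_matrix M (X i) = \<Sigma> i"
    and "\<And>i. i \<le> T \<Longrightarrow> pos_definite (\<Sigma> i)"
    and "\<And>i. i \<le> T \<Longrightarrow> 1 + rf i \<noteq> 0"
    and "t \<in> {1..T}"
    and "1 \<bullet> (matrix_inv (\<Sigma> (T - t + 1)) *v excess_mean rf \<mu> (T - t + 1)) \<noteq> 0"
  shows "(\<exists>!w. is_tangency_portfolio (\<Sigma> (T - t + 1)) (excess_mean rf \<mu> (T - t + 1)) w) \<and>
    (\<forall>w. is_tangency_portfolio (\<Sigma> (T - t + 1)) (excess_mean rf \<mu> (T - t + 1)) w \<longrightarrow>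
      (AE \<omega> in M.
        let A = A_breve M F (excess_return rf X) (excess_mean rf \<mu>) \<Sigma> T (T - t + 1) \<omega>;
            v = matrix_inv A *v excess_mean rf \<mu> (T - t + 1)
        in invertible A \<and> 1 \<bullet> v \<noteq> 0 \<and> w = v /\<^sub>R (1 \<bullet> v)) \<and>
      (let v = matrix_inv (\<Sigma> (T - t + 1)) *v excess_mean rf \<mu> (T - t + 1)
       in w = v /\<^sub>R (1 \<bullet> v)))"
proof -
  interpret prob_space M by fact
  define i where "i = T - t + 1"
  have i: "1 \<le> i" "i \<le> T"
    using \<open>t \<in> {1..T}\<close> by (auto simp: i_def)
  define m where "m = excess_mean rf \<mu> i"
  define u where "u = matrix_inv (\<Sigma> i) *v m"
  have nz: "1 \<bullet> u \<noteq> 0"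
    using assms(13) by (simp add: u_def m_def i_def)
  have pd: "pos_definite (\<Sigma> i)"
    using assms(10) i by simp
  have "\<exists>c. 0 < c \<and> c \<le> 1 \<and> (AE \<omega> in M.
      A_breve M F (excess_return rf X) (excess_mean rf \<mu>) \<Sigma> T i \<omega>
        = c *\<^sub>R (\<Sigma> i + outer (excess_mean rf \<mu> i) (excess_mean rf \<mu> i)) \<and>
      mu_star M F (excess_return rf X) (excess_mean rf \<mu>) \<Sigma> T i \<omega> = c *\<^sub>R excess_mean rf \<mu> i)"
    \<comment> \<open>Adaptedness gives measurability with respect to \<open>M\<close>, since each
      \<open>F i\<close> is a subalgebra.\<close>
    using assms(3) measurable_from_subalg[OF assms(3) assms(4)] assms(6-10) i
    by (rule A_breve_mu_star_AE_proportional)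
  then obtain c where c: "0 < c"
    and A: "AE \<omega> in M. A_breve M F (excess_return rf X) (excess_mean rf \<mu>) \<Sigma> T i \<omega>
        = c *\<^sub>R (\<Sigma> i + outer m m)"
    unfolding m_def by auto
  define d where "d = 1 / (c * (1 + m \<bullet> u))"
  have d: "d > 0"
    using c pos_definite_inv_form_nonneg[OF pd, of m]
    by (simp add: d_def u_def add_pos_nonneg)
  have inv: "matrix_inv (c *\<^sub>R (\<Sigma> i + outer m m)) *v m = d *\<^sub>R u"
    unfolding d_def u_def by (rule matrix_inv_scaled_rank_one_update[OF pd c])
  \<comment> \<open>The candidate \<open>u /\<^sub>R (1 \<bullet> u)\<close> does not depend on
    \<omega>, so it can be compared with the random expression directly. Almost surely
    \<open>v\<close> is \<open>d *\<^sub>R u\<close> with \<open>d > 0\<close>, which keeps the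
    denominator nonzero and cancels.\<close>
  have "AE \<omega> in M.
        let A = A_breve M F (excess_return rf X) (excess_mean rf \<mu>) \<Sigma> T i \<omega>;
            v = matrix_inv A *v m
        in invertible A \<and> 1 \<bullet> v \<noteq> 0 \<and> u /\<^sub>R (1 \<bullet> u) = v /\<^sub>R (1 \<bullet> v)"
    using A
  proof eventually_elim
    case (elim \<omega>)
    show ?case
      unfolding elim Let_def inv
      using invertible_scaled_rank_one_update[OF pd c] nz d by simp
  qed
  moreover have "is_tangency_portfolio (\<Sigma> i) m w \<longleftrightarrow> w = u /\<^sub>R (1 \<bullet> u)" for w
    using is_tangency_portfolio_iff[of "\<Sigma> i" m w] nz by (simp add: u_def)
  ultimately show ?thesis
    unfolding i_def[symmetric] m_def[symmetric] u_def[symmetric] Let_def by simp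
qed

end
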